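(* There is no multiplicative functional $\mathcal{F}:\mathbb{H}^{n\times n}\to\mathbb{H}$ which coincides with $\det$ on complex diagonal matrices. That is, there is no map $\mathcal{F}:\mathbb{H}^{n\times n}\to\mathbb{H}$ such that $\mathcal{F}[MN]=\mathcal{F}[M]\,\mathcal{F}[N]$ for all $M,N\in\mathbb{H}^{n\times n}$ and $\mathcal{F}[D]=\det D$ for every diagonal matrix $D\in\mathbb{C}^{n\times n}$.
   Context: $\mathbb{H}$ is the skew-field of real quaternions $q=a+ib+jc+kd$ with $a,b,c,d\in\mathbb{R}$ and $i^2=j^2=k^2=ijk=-1$. $\mathbb{H}^{n\times n}$ is the set of $n\times n$ matrices with entries in $\mathbb{H}$. $\mathbb{C}=\{a+ib : a,b\in\mathbb{R}\}$ is regarded as a subfield of $\mathbb{H}$, so $\mathbb{C}^{n\times n}\subset\mathbb{H}^{n\times n}$. $\det$ is the usual determinant of complex matrices.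
   Formalization: The formal theorem assumes n ≥ 2; for n = 1 the claim as written fails, since sending a 1×1 quaternionic matrix to its single entry is multiplicative and coincides with det on complex diagonal matrices. *)

theory Defs
  imports "HOL-Analysis.Analysis"
begin

text \<open>The skew field of real quaternions; \<open>Quat a b c d\<close> stands for \<open>a + ib + jc + kd\<close>.\<close>

codatatype quat = Quat (qRe: real) (qIm1: real) (qIm2: real) (qIm3: real)

lemma quat_eqI [intro?]:
  "\<lbrakk>qRe x = qRe y; qIm1 x = qIm1 y; qIm2 x = qIm2 y; qIm3 x = qIm3 y\<rbrakk> \<Longrightarrow> x = y"
  by (rule quat.expand) simp

lemma quat_eq_iff:
  "x = y \<longleftrightarrow> qRe x = qRe y \<and> qIm1 x = qIm1 y \<and> qIm2 x = qIm2 y \<and> qIm3 x = qIm3 y"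
  by (auto intro: quat.expand)

instantiation quat :: real_div_algebra
begin

primcorec zero_quat where
  "qRe 0 = 0"
| "qIm1 0 = 0"
| "qIm2 0 = 0"
| "qIm3 0 = 0"

primcorec one_quat where
  "qRe 1 = 1"
| "qIm1 1 = 0"
| "qIm2 1 = 0"
| "qIm3 1 = 0"

primcorec plus_quat where
  "qRe (x + y) = qRe x + qRe y"
| "qIm1 (x + y) = qIm1 x + qIm1 y"
| "qIm2 (x + y) = qIm2 x + qIm2 y"
| "qIm3 (x + y) = qIm3 x + qIm3 y"

primcorec uminus_quat where
  "qRe (- x) = - qRe x"
| "qIm1 (- x) = - qIm1 x"
| "qIm2 (- x) = - qIm2 x"
| "qIm3 (- x) = - qIm3 x"

primcorec minus_quat where
  "qRe (x - y) = qRe x - qRe y"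
| "qIm1 (x - y) = qIm1 x - qIm1 y"
| "qIm2 (x - y) = qIm2 x - qIm2 y"
| "qIm3 (x - y) = qIm3 x - qIm3 y"

primcorec scaleR_quat where
  "qRe (scaleR r x) = r * qRe x"
| "qIm1 (scaleR r x) = r * qIm1 x"
| "qIm2 (scaleR r x) = r * qIm2 x"
| "qIm3 (scaleR r x) = r * qIm3 x"

primcorec times_quat where
  "qRe (x * y) = qRe x * qRe y - qIm1 x * qIm1 y - qIm2 x * qIm2 y - qIm3 x * qIm3 y"
| "qIm1 (x * y) = qRe x * qIm1 y + qIm1 x * qRe y + qIm2 x * qIm3 y - qIm3 x * qIm2 y"
| "qIm2 (x * y) = qRe x * qIm2 y - qIm1 x * qIm3 y + qIm2 x * qRe y + qIm3 x * qIm1 y"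
| "qIm3 (x * y) = qRe x * qIm3 y + qIm1 x * qIm2 y - qIm2 x * qIm1 y + qIm3 x * qRe y"

text \<open>The inverse is the conjugate divided by the squared norm.\<close>

primcorec inverse_quat where
  "qRe (inverse x) = qRe x / ((qRe x)\<^sup>2 + (qIm1 x)\<^sup>2 + (qIm2 x)\<^sup>2 + (qIm3 x)\<^sup>2)"
| "qIm1 (inverse x) = - qIm1 x / ((qRe x)\<^sup>2 + (qIm1 x)\<^sup>2 + (qIm2 x)\<^sup>2 + (qIm3 x)\<^sup>2)"
| "qIm2 (inverse x) = - qIm2 x / ((qRe x)\<^sup>2 + (qIm1 x)\<^sup>2 + (qIm2 x)\<^sup>2 + (qIm3 x)\<^sup>2)"
| "qIm3 (inverse x) = - qIm3 x / ((qRe x)\<^sup>2 + (qIm1 x)\<^sup>2 + (qIm2 x)\<^sup>2 + (qIm3 x)\<^sup>2)"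

definition divide_quat where
  "x div y = x * inverse y" for x y :: quat

instance
proof
  fix x :: quat
  assume "x \<noteq> 0"
  define N where "N = (qRe x)\<^sup>2 + (qIm1 x)\<^sup>2 + (qIm2 x)\<^sup>2 + (qIm3 x)\<^sup>2"
  have "N \<noteq> 0"
    using \<open>x \<noteq> 0\<close> by (auto simp: N_def quat_eq_iff add_nonneg_eq_0_iff)
  have re: "qRe x * qRe x / N + qIm1 x * qIm1 x / N + qIm2 x * qIm2 x / N + qIm3 x * qIm3 x / N = 1"
    using \<open>N \<noteq> 0\<close> by (simp add: N_def power2_eq_square flip: add_divide_distrib)
  have inv: "inverse x = Quat (qRe x / N) (- qIm1 x / N) (- qIm2 x / N) (- qIm3 x / N)"
    by (simp add: quat_eq_iff N_def)
  show "inverse x * x = 1" "x * inverse x = 1"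
    unfolding inv using re by (simp_all add: quat_eq_iff mult.commute)
qed (simp_all add: quat_eq_iff algebra_simps divide_quat_def add_divide_distrib)

end

definition quat_i :: quat where "quat_i = Quat 0 1 0 0"
definition quat_j :: quat where "quat_j = Quat 0 0 1 0"
definition quat_k :: quat where "quat_k = Quat 0 0 0 1"

lemma quat_of_real_sel [simp]:
  "qRe (of_real r) = r" "qIm1 (of_real r) = 0" "qIm2 (of_real r) = 0" "qIm3 (of_real r) = 0"
  by (simp_all add: of_real_def)

lemma Quat_eq:
  "Quat a b c d = of_real a + quat_i * of_real b + quat_j * of_real c + quat_k * of_real d"
  by (simp add: quat_eq_iff quat_i_def quat_j_def quat_k_def)

lemma quat_units:
  "quat_i * quat_i = -1" "quat_j * quat_j = -1" "quat_k * quat_k = -1"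
  "quat_i * quat_j * quat_k = -1"
  by (simp_all add: quat_eq_iff quat_i_def quat_j_def quat_k_def)

text \<open>The inclusion of \<open>\<complex> = {a + ib}\<close> as a subfield of the quaternions.\<close>

definition quat_of_complex :: "complex \<Rightarrow> quat" where
  "quat_of_complex z = Quat (Re z) (Im z) 0 0"

lemma inj_quat_of_complex: "inj quat_of_complex"
  by (auto intro!: injI complex_eqI simp: quat_of_complex_def)

lemma quat_of_complex_hom:
  "quat_of_complex 0 = 0" "quat_of_complex 1 = 1"
  "quat_of_complex (z + w) = quat_of_complex z + quat_of_complex w"
  "quat_of_complex (z * w) = quat_of_complex z * quat_of_complex w"
  "quat_of_complex (of_real r) = of_real r" "quat_of_complex \<i> = quat_i"
  by (simp_all add: quat_of_complex_def quat_eq_iff quat_i_def)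

definition diagonal_matrix :: "'a::zero ^'n^'n \<Rightarrow> bool" where
  "diagonal_matrix D \<longleftrightarrow> (\<forall>r c. r \<noteq> c \<longrightarrow> D $ r $ c = 0)"

end

theory Submission
  imports Defs
begin

text \<open>
  Put \<open>j\<close> in one diagonal entry of the identity matrix, at position \<open>a\<close>, to get \<open>J\<close>. Since
  \<open>J\<^sup>2\<close> has \<open>-1\<close> at that position, \<open>F J\<close> squares to \<open>-1\<close>. Let \<open>D\<^sub>p\<close> have \<open>i\<close> in the diagonal
  entry \<open>p\<close>. Every such \<open>D\<^sub>p\<close> is sent to \<open>i\<close>, regardless of \<open>p\<close>. But \<open>J\<close> commutes with \<open>D\<^sub>b\<close>
  for \<open>b \<noteq> a\<close>, so \<open>F J\<close> commutes with \<open>i\<close>, whereas \<open>D\<^sub>a J = J D\<^sub>a\<^sup>-\<^sup>1\<close> shows that \<open>F J\<close>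
  anticommutes with \<open>i\<close>. Hence \<open>F J = 0\<close>, a contradiction.
\<close>

definition diag_entry :: "'n::finite \<Rightarrow> 'a::semiring_1 \<Rightarrow> 'a^'n^'n" where
  "diag_entry a x = (\<chi> r c. if r = c then (if r = a then x else 1) else 0)"

lemma diag_entry_mult:
  "(diag_entry a x ** diag_entry b y) $ r $ c =
     (if r = c then (if r = a then x else 1) * (if r = b then y else 1) else 0)"
proof -
  \<comment> \<open>Row \<open>r\<close> of the left factor vanishes off the diagonal, so only
    \<open>k = r\<close> contributes.\<close>
  have "(diag_entry a x ** diag_entry b y) $ r $ c =
      (\<Sum>k\<in>UNIV. if k = r then (if r = a then x else 1) * diag_entry b y $ r $ c else 0)"
    unfolding matrix_matrix_mult_def vec_lambda_beta
    by (rule sum.cong) (auto simp: diag_entry_def)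
  then show ?thesis
    by (simp add: diag_entry_def)
qed

lemma diag_entry_mult_same: "diag_entry a x ** diag_entry a y = diag_entry a (x * y)"
  by (simp add: vec_eq_iff diag_entry_mult) (simp add: diag_entry_def)

lemma diag_entry_commute:
  "a \<noteq> b \<Longrightarrow> diag_entry a x ** diag_entry b y = diag_entry b y ** diag_entry a x"
  by (auto simp: vec_eq_iff diag_entry_mult)

lemma diagonal_matrix_diag_entry: "diagonal_matrix (diag_entry a x)"
  by (simp add: diagonal_matrix_def diag_entry_def)

lemma det_diag_entry: "det (diag_entry a x) = (x :: 'a::comm_ring_1)"
  by (subst det_diagonal) (simp_all add: diag_entry_def)

lemma map_matrix_diag_entry:
  "map_matrix quat_of_complex (diag_entry a z) = diag_entry a (quat_of_complex z)"
  by (simp add: vec_eq_iff map_matrix_def diag_entry_def quat_of_complex_hom)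

text \<open>For 1 by 1 matrices, taking the sole entry is such a functional, hence the bound on the
  size.\<close>

theorem mainTheorem1:
  assumes "CARD('n::finite) \<ge> 2"
  shows "\<not> (\<exists>F :: quat^'n^'n \<Rightarrow> quat.
           (\<forall>M N. F (M ** N) = F M * F N) \<and>
           (\<forall>D :: complex^'n^'n. diagonal_matrix D \<longrightarrow>
              F (map_matrix quat_of_complex D) = quat_of_complex (det D)))"
proof
  assume "\<exists>F :: quat^'n^'n \<Rightarrow> quat.
           (\<forall>M N. F (M ** N) = F M * F N) \<and>
           (\<forall>D :: complex^'n^'n. diagonal_matrix D \<longrightarrow>
              F (map_matrix quat_of_complex D) = quat_of_complex (det D))"
  then obtain F :: "quat^'n^'n \<Rightarrow> quat"
    where mult: "F (M ** N) = F M * F N"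
      and diag: "diagonal_matrix D \<Longrightarrow>
        F (map_matrix quat_of_complex D) = quat_of_complex (det D)" for M N D
    by blast
  have F_entry: "F (diag_entry a (quat_of_complex z)) = quat_of_complex z" for a z
    using diag[OF diagonal_matrix_diag_entry[of a z]]
    by (simp add: det_diag_entry map_matrix_diag_entry)
  have minus: "quat_of_complex (-1) = -1" "quat_of_complex (-\<i>) = -quat_i"
    by (simp_all add: quat_of_complex_def quat_eq_iff quat_i_def)
  have Fi: "F (diag_entry a quat_i) = quat_i" "F (diag_entry a (-quat_i)) = -quat_i"
    "F (diag_entry a (-1)) = -1" for a
    using F_entry[of a \<i>] F_entry[of a "-\<i>"] F_entry[of a "-1"]
    by (simp_all only: minus quat_of_complex_hom)
  obtain a b :: 'n where "a \<noteq> b"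
    using assms card_le_Suc0_iff_eq[of "UNIV :: 'n set"] by auto
  define u where "u = F (diag_entry a quat_j)"
  have "quat_i * u = u * quat_i"
    using arg_cong[OF diag_entry_commute[OF \<open>a \<noteq> b\<close>, of quat_j quat_i], of F]
    by (simp add: mult Fi(1) u_def)
  \<comment> \<open>Moving \<open>quat_j\<close> across leaves the entry \<open>- quat_i\<close>,
    again complex, so \<open>Fi\<close> still evaluates \<open>F\<close> there.\<close>
  moreover have "quat_i * quat_j = quat_j * (- quat_i)"
    by (simp add: quat_eq_iff quat_i_def quat_j_def)
  then have "diag_entry a quat_i ** diag_entry a quat_j =
      diag_entry a quat_j ** diag_entry a (- quat_i)"
    by (simp only: diag_entry_mult_same)
  from arg_cong[OF this, of F] have "quat_i * u = u * (- quat_i)"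
    by (simp only: mult Fi(1,2) u_def)
  \<comment> \<open>Now \<open>u * quat_i\<close> equals its own negative; up to sign its components
    are those of \<open>u\<close>.\<close>
  ultimately have "u = 0"
    by (simp add: quat_eq_iff quat_i_def)
  moreover have "u * u = -1"
    by (simp only: u_def Fi(3) diag_entry_mult_same quat_units(2) flip: mult)
  ultimately show False
    by simp
qed

end
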